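(* Let $\gamma\in(0,1]$, $\lambda>0$, $\kappa\in[0,1)$. The symmetric discrete stable distribution $\mathrm{SDS}(\gamma,\lambda,\kappa)$ belongs to the domain of normal attraction of the symmetric $\alpha$-stable distribution with $\alpha=2\gamma$ and characteristic function $$g(t)=\exp\left\{-\frac{\lambda}{2^{\gamma}}\frac{(1+\kappa)^{\gamma}}{(1-\kappa)^{2\gamma}}|t|^{2\gamma}\right\}.$$
   Context: For $\gamma\in(0,1]$, $\lambda>0$, $\kappa\in[0,1)$, $\mathrm{SDS}(\gamma,\lambda,\kappa)$ denotes the symmetric distribution on $\mathbb{Z}$ with characteristic function $$f(t)=\exp\left\{-\lambda\left(\frac{(1-\cos t)(1+\kappa)}{\kappa^2-2\kappa\cos t+1}\right)^{\gamma}\right\}.$$ Belonging to the domain of normal attraction of the law with characteristic function $g$ (index $\alpha$) means here: if $X_1,X_2,\dots$ are i.i.d. with the given distribution, then $n^{-1/\alpha}(X_1+\dots+X_n)$ converges in distribution, as $n\to\infty$, to the law with characteristic function $g$. *)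

theory Defs
  imports "HOL-Probability.Probability"
begin

definition sds_cf :: "real \<Rightarrow> real \<Rightarrow> real \<Rightarrow> real \<Rightarrow> real" where
  "sds_cf \<gamma> lam \<kappa> t =
     exp (- lam * (((1 - cos t) * (1 + \<kappa>)) / (\<kappa>\<^sup>2 - 2 * \<kappa> * cos t + 1)) powr \<gamma>)"

definition SDS :: "real \<Rightarrow> real \<Rightarrow> real \<Rightarrow> int pmf" where
  "SDS \<gamma> lam \<kappa> =
     (THE p. (\<forall>k. pmf p (- k) = pmf p k) \<and>
             (\<forall>t. char (distr (measure_pmf p) borel real_of_int) t
                  = complex_of_real (sds_cf \<gamma> lam \<kappa> t)))"

(* The last conjunct says that a X + b Y has the same law as (a^\<alpha> + b^\<alpha>)^(1/\<alpha>) X for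
   independent X, Y with law L; a symmetric law needs no centering term. Point masses are
   excluded, so that the index \<alpha> is determined by L. *)
definition symmetric_stable :: "real \<Rightarrow> real measure \<Rightarrow> bool" where
  "symmetric_stable \<alpha> L \<longleftrightarrow>
     real_distribution L \<and>
     distr L borel uminus = L \<and>
     (\<forall>x. L \<noteq> return borel x) \<and>
     (\<forall>a>0. \<forall>b>0. distr (L \<Otimes>\<^sub>M L) borel (\<lambda>(x, y). a * x + b * y)
                   = distr L borel (\<lambda>x. (a powr \<alpha> + b powr \<alpha>) powr (1 / \<alpha>) * x))"

(* HOL cannot quantify over the type of the sample space inside a formula, so that type is an
   explicit (in theorems: arbitrary) parameter. *)
definition in_domain_of_normal_attraction ::
    "'a itself \<Rightarrow> int pmf \<Rightarrow> real \<Rightarrow> real measure \<Rightarrow> bool" where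
  "in_domain_of_normal_attraction _ p \<alpha> L \<longleftrightarrow>
     (\<forall>(M :: 'a measure) (X :: nat \<Rightarrow> 'a \<Rightarrow> int).
        prob_space M \<longrightarrow>
        prob_space.indep_vars M (\<lambda>_. count_space UNIV) X UNIV \<longrightarrow>
        (\<forall>i. distr M (count_space UNIV) (X i) = measure_pmf p) \<longrightarrow>
        weak_conv_m
          (\<lambda>n. distr M borel (\<lambda>\<omega>. real n powr (- 1 / \<alpha>) * (\<Sum>i<n. real_of_int (X i \<omega>))))
          L)"

end

theory Submission
  imports Defs
begin

text \<open>
  Write the exponent of the characteristic function as \<open>lam * h(t) powr \<gamma>\<close>. Everything rests on two
  facts about \<open>h\<close>.

  Globally, \<open>1 - h\<close> is itself a characteristic function: that of a random sign times
  \<open>1 + G\<close>, where \<open>G\<close> is geometric with failure probability \<open>\<kappa>\<close> (\<open>int_char_sds_step\<close>). For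
  \<open>0 < \<gamma> \<le> 1\<close> the function \<open>1 - (1 - s) powr \<gamma>\<close> is a probability generating function (Sibuya's
  law), so \<open>1 - h powr \<gamma>\<close> is the characteristic function of a Sibuya-distributed number of such
  steps, and a Poisson number of these sums has characteristic function
  \<open>exp (- lam * h powr \<gamma>)\<close>. Hence the law \<open>SDS\<close> exists; characteristic functions determine laws, so
  it is unique and its symmetry is automatic (\<open>int_char_SDS\<close>).

  Locally, \<open>h(s)\<close> is asymptotic to \<open>K * s\<^sup>2\<close> at \<open>0\<close>, with \<open>K = (1 + \<kappa>) / (2 * (1 - \<kappa>)\<^sup>2)\<close>, and is
  at most \<open>K * s\<^sup>2\<close> everywhere. For \<open>a = n powr (-1 / (2 * \<gamma>))\<close> this makes
  \<open>n * h(a * t) powr \<gamma>\<close> converge to \<open>K powr \<gamma> * \<bar>t\<bar> powr (2 * \<gamma>)\<close>, so the characteristic functions of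
  the normalised sums converge to the claimed function \<open>g\<close>.

  It remains to see that \<open>g\<close> belongs to a probability law. Since \<open>n\<close> independent copies of
  \<open>SDS \<gamma> lam \<kappa>\<close> add up to \<open>SDS \<gamma> (n * lam) \<kappa>\<close>, the rescalings of the latter have
  characteristic functions tending to \<open>g\<close>; the global bound on \<open>h\<close> makes these laws tight
  (\<open>tight_of_char_bound\<close>), and any subsequential limit has characteristic function \<open>g\<close>. The form of
  \<open>g\<close> gives symmetric stability, and Levy's continuity theorem gives the convergence in law.
\<close>

section \<open>Characteristic functions of random sums on the integers\<close>

abbreviation int_char :: "int pmf \<Rightarrow> real \<Rightarrow> complex" where
  "int_char p t \<equiv> char (distr (measure_pmf p) borel real_of_int) t"

lemma real_distribution_int_pmf: "real_distribution (distr (measure_pmf p) borel real_of_int)"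
  by (rule prob_space.real_distribution_distr[OF prob_space_measure_pmf]) simp

lemma int_char_eq: "int_char p t = (\<integral>k. iexp (t * real_of_int k) \<partial>measure_pmf p)"
  by (simp add: char_def integral_distr)

lemma integrable_pmf_bounded:
  fixes h :: "'b \<Rightarrow> 'c::{banach, second_countable_topology}"
  assumes "\<And>x. norm (h x) \<le> B"
  shows "integrable (measure_pmf p) h"
  by (rule measure_pmf.integrable_const_bound[where B = B]) (auto simp: assms)

text \<open>
  Adding the bound \<open>B\<close> to \<open>h\<close> makes it nonnegative; for nonnegative integrals the iterated
  integral formula \<open>nn_integral_bind_pmf\<close> needs no integrability.
\<close>
lemma expectation_bind_pmf_real:
  fixes h :: "'b \<Rightarrow> real"
  assumes "\<And>x. \<bar>h x\<bar> \<le> B"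
  shows "measure_pmf.expectation (bind_pmf q f) h
           = measure_pmf.expectation q (\<lambda>x. measure_pmf.expectation (f x) h)"
proof -
  define g where "g x = h x + B" for x
  have g0: "g x \<ge> 0" for x using assms[of x] by (simp add: g_def)
  have gB: "norm (g x) \<le> 2 * B" for x using assms[of x] by (simp add: g_def)
  note int = integrable_pmf_bounded[of g, OF gB] integrable_pmf_bounded[of h B]
  have Eg: "measure_pmf.expectation p g = measure_pmf.expectation p h + B" for p
    unfolding g_def using int(2) assms by (simp add: measure_pmf.prob_space)
  have Eb: "\<bar>measure_pmf.expectation p h\<bar> \<le> B" for p
  proof -
    have "norm (measure_pmf.expectation p h) \<le> measure_pmf.expectation p (\<lambda>x. norm (h x))"
      by (rule integral_norm_bound)
    also have "\<dots> \<le> B"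
      using assms by (intro measure_pmf.integral_le_const integrable_pmf_bounded[where B = B]) auto
    finally show ?thesis by simp
  qed
  have Eg0: "0 \<le> measure_pmf.expectation p g" for p
    using g0 by (intro Bochner_Integration.integral_nonneg) auto
  have Egb: "norm (measure_pmf.expectation p g) \<le> 2 * B" for p
    using Eb[of p] by (simp add: Eg)
  have "ennreal (measure_pmf.expectation (bind_pmf q f) g) = (\<integral>\<^sup>+x. ennreal (g x) \<partial>bind_pmf q f)"
    using int(1) g0 by (subst nn_integral_eq_integral) auto
  also have "\<dots> = (\<integral>\<^sup>+x. ennreal (measure_pmf.expectation (f x) g) \<partial>q)"
    using int(1) g0 by (simp add: nn_integral_eq_integral)
  also have "\<dots> = ennreal (measure_pmf.expectation q (\<lambda>x. measure_pmf.expectation (f x) g))"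
    using Egb Eg0 by (intro nn_integral_eq_integral integrable_pmf_bounded[where B = "2 * B"]) auto
  finally have "measure_pmf.expectation (bind_pmf q f) g
      = measure_pmf.expectation q (\<lambda>x. measure_pmf.expectation (f x) g)"
    by (subst (asm) ennreal_inj) (use Eg0 in \<open>auto intro!: Bochner_Integration.integral_nonneg\<close>)
  also have "\<dots> = measure_pmf.expectation q (\<lambda>x. measure_pmf.expectation (f x) h) + B"
    unfolding Eg using Eb
    by (subst Bochner_Integration.integral_add)
       (auto simp: measure_pmf.prob_space intro!: integrable_pmf_bounded[where B = B])
  finally show ?thesis by (simp add: Eg)
qed

lemma int_char_bind_pmf:
  "int_char (bind_pmf q f) t = measure_pmf.expectation q (\<lambda>x. int_char (f x) t)"
proof -
  have int: "integrable (measure_pmf p) (\<lambda>k. iexp (t * real_of_int k))" for p :: "int pmf"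
    by (rule integrable_pmf_bounded[where B = 1]) simp
  have le: "norm (int_char p t) \<le> 1" for p
    by (rule real_distribution.cmod_char_le_1) (rule real_distribution_int_pmf)
  have int2: "integrable q (\<lambda>x. int_char (f x) t)"
    by (rule integrable_pmf_bounded[OF le])
  show ?thesis
  proof (rule complex_eqI)
    show "Re (int_char (bind_pmf q f) t) = Re (measure_pmf.expectation q (\<lambda>x. int_char (f x) t))"
      unfolding integral_Re[OF int2, symmetric] unfolding int_char_eq integral_Re[OF int, symmetric]
      by (rule expectation_bind_pmf_real[where B = 1]) (simp add: Re_exp)
    show "Im (int_char (bind_pmf q f) t) = Im (measure_pmf.expectation q (\<lambda>x. int_char (f x) t))"
      unfolding integral_Im[OF int2, symmetric] unfolding int_char_eq integral_Im[OF int, symmetric]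
      by (rule expectation_bind_pmf_real[where B = 1]) (simp add: Im_exp)
  qed
qed

lemma int_char_map_add:
  "int_char (map_pmf ((+) a) p) t = iexp (t * real_of_int a) * int_char p t"
proof -
  have "iexp (t * real_of_int (a + k)) = iexp (t * real_of_int a) * iexp (t * real_of_int k)" for k
    by (simp add: distrib_left flip: exp_add)
  then show ?thesis by (simp add: int_char_eq)
qed

primrec iid_sum_pmf :: "int pmf \<Rightarrow> nat \<Rightarrow> int pmf" where
  "iid_sum_pmf p 0 = return_pmf 0"
| "iid_sum_pmf p (Suc n) = bind_pmf p (\<lambda>a. map_pmf ((+) a) (iid_sum_pmf p n))"

lemma int_char_iid_sum_pmf: "int_char (iid_sum_pmf p n) t = int_char p t ^ n"
proof (induction n)
  case 0
  show ?case by (simp add: int_char_eq)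
next
  case (Suc n)
  have "int_char (iid_sum_pmf p (Suc n)) t
      = (\<integral>a. iexp (t * real_of_int a) * int_char p t ^ n \<partial>p)"
    by (simp add: int_char_bind_pmf int_char_map_add Suc)
  also have "\<dots> = int_char p t ^ Suc n"
    by (simp add: int_char_eq)
  finally show ?case .
qed

lemma expectation_nat_pmf_sums:
  fixes h :: "nat \<Rightarrow> real"
  assumes "\<And>n. \<bar>h n\<bar> \<le> B" and "(\<lambda>n. pmf q n * h n) sums S"
  shows "measure_pmf.expectation q h = S"
proof -
  have "integrable q h"
    using assms(1) by (intro integrable_pmf_bounded[where B = B]) simp
  then have "integrable (count_space UNIV) (\<lambda>n. pmf q n * h n)"
    unfolding measure_pmf_eq_density by (subst (asm) integrable_density) auto
  then have "(\<integral>n. pmf q n * h n \<partial>count_space UNIV) = (\<Sum>n. pmf q n * h n)"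
    by (rule integral_count_space_nat)
  moreover have "measure_pmf.expectation q h = (\<integral>n. pmf q n * h n \<partial>count_space UNIV)"
    unfolding measure_pmf_eq_density by (subst integral_density) auto
  ultimately show ?thesis using assms(2) by (simp add: sums_iff)
qed

text \<open>
  Conditioning on the number of summands turns the characteristic function of a random sum into
  the generating function of that number, evaluated at the characteristic function of a summand.
  The point \<open>t\<close> is fixed, so \<open>G\<close> is only the value of the generating function at \<open>s\<close>.
\<close>
lemma int_char_random_sum:
  assumes "int_char p t = complex_of_real s" and "(\<lambda>n. pmf q n * s ^ n) sums G"
  shows "int_char (bind_pmf q (iid_sum_pmf p)) t = complex_of_real G"
proof -
  have "norm (int_char p t) \<le> 1" by (rule real_distribution.cmod_char_le_1[OF real_distribution_int_pmf])
  then have s: "\<bar>s\<bar> \<le> 1" by (simp add: assms)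
  have "int_char (bind_pmf q (iid_sum_pmf p)) t = complex_of_real (\<integral>n. s ^ n \<partial>q)"
    by (simp add: int_char_bind_pmf int_char_iid_sum_pmf assms flip: of_real_power)
  also have "(\<integral>n. s ^ n \<partial>q) = G"
    using s assms(2) by (intro expectation_nat_pmf_sums[where B = 1]) (simp_all add: power_abs power_le_one)
  finally show ?thesis .
qed

lemma poisson_pgf:
  assumes "0 < r"
  shows "(\<lambda>n. pmf (poisson_pmf r) n * s ^ n) sums exp (- r * (1 - s))"
proof -
  have "(\<lambda>n. exp (-r) * ((r * s) ^ n /\<^sub>R fact n)) sums (exp (-r) * exp (r * s))"
    by (intro sums_mult exp_converges)
  then show ?thesis
    using assms by (simp add: field_simps power_mult_distrib flip: exp_add)
qed

section \<open>The Sibuya law\<close>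

text \<open>
  The coefficients of \<open>1 - (1 - s) powr \<gamma>\<close>; the case distinction supplies the leading \<open>1\<close>, which
  cancels the constant term of the binomial series.
\<close>
definition sibuya_mass :: "real \<Rightarrow> nat \<Rightarrow> real" where
  "sibuya_mass \<gamma> n = (if n = 0 then 1 else 0) - (-1) ^ n * (\<gamma> gchoose n)"

text \<open>
  From index \<open>1\<close> on, consecutive coefficients have ratio \<open>(n - \<gamma>) / (n + 1)\<close>, which is
  nonnegative because \<open>\<gamma> \<le> 1\<close>; the first one is \<open>\<gamma>\<close>.
\<close>
lemma sibuya_mass_nonneg:
  assumes "0 < \<gamma>" "\<gamma> \<le> 1"
  shows "0 \<le> sibuya_mass \<gamma> n"
proof -
  have "0 \<le> - ((-1) ^ Suc n * (\<gamma> gchoose Suc n))" for n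
  proof (induction n)
    case 0
    show ?case using assms by simp
  next
    case (Suc n)
    define c where "c = - ((-1) ^ Suc n * (\<gamma> gchoose Suc n))"
    have "- ((-1) ^ Suc (Suc n) * (\<gamma> gchoose Suc (Suc n))) = c * (real (Suc n) - \<gamma>) / real (Suc (Suc n))"
    proof -
      have "real (Suc (Suc n)) * (\<gamma> gchoose Suc (Suc n)) = (\<gamma> - real (Suc n)) * (\<gamma> gchoose Suc n)"
        using gbinomial_mult_1[of \<gamma> "Suc n"] by (simp add: left_diff_distrib del: of_nat_Suc)
      then have "\<gamma> gchoose Suc (Suc n) = (\<gamma> - real (Suc n)) * (\<gamma> gchoose Suc n) / real (Suc (Suc n))"
        by (simp add: eq_divide_eq mult.commute del: of_nat_Suc)
      then show ?thesis
        unfolding c_def by (simp only:) (simp add: field_simps del: of_nat_Suc)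
    qed
    moreover have "0 \<le> c" using Suc by (simp add: c_def)
    ultimately show ?case using assms by simp
  qed
  then show ?thesis
    by (cases n) (auto simp: sibuya_mass_def)
qed

lemma sibuya_mass_sums_open:
  assumes "\<bar>s\<bar> < 1"
  shows "(\<lambda>n. sibuya_mass \<gamma> n * s ^ n) sums (1 - (1 - s) powr \<gamma>)"
proof -
  have "(\<lambda>n. (\<gamma> gchoose n) * (- s) ^ n) sums (1 - s) powr \<gamma>"
    using gen_binomial_real[of "- s" \<gamma>] assms by simp
  moreover have "(\<lambda>n. if n = 0 then 1 else (0::real)) sums 1"
    using sums_single[of 0 "\<lambda>_. 1::real"] by simp
  ultimately have "(\<lambda>n. (if n = 0 then 1 else 0) - (\<gamma> gchoose n) * (- s) ^ n) sums (1 - (1 - s) powr \<gamma>)"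
    by (intro sums_diff)
  moreover have "(if n = 0 then 1 else 0) - (\<gamma> gchoose n) * (- s) ^ n = sibuya_mass \<gamma> n * s ^ n" for n
    by (simp add: sibuya_mass_def power_minus[of s])
  ultimately show ?thesis by simp
qed

text \<open>
  By nonnegativity every partial sum at \<open>0 < s < 1\<close> is below the full series, hence below \<open>1\<close>;
  letting \<open>s\<close> tend to \<open>1\<close> bounds the partial sums of the coefficients.
\<close>
lemma summable_sibuya_mass:
  assumes "0 < \<gamma>" "\<gamma> \<le> 1"
  shows "summable (sibuya_mass \<gamma>)"
proof (rule summableI_nonneg_bounded)
  fix N
  have "((\<lambda>s. \<Sum>n<N. sibuya_mass \<gamma> n * s ^ n) \<longlongrightarrow> (\<Sum>n<N. sibuya_mass \<gamma> n * 1 ^ n)) (at_left 1)"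
    by (intro tendsto_intros)
  moreover have "\<forall>\<^sub>F s in at_left (1::real). (\<Sum>n<N. sibuya_mass \<gamma> n * s ^ n) \<le> 1"
    using eventually_at_left_real[of 0 1]
  proof (rule eventually_mono)
    fix s :: real assume s: "s \<in> {0<..<1}"
    then have "(\<lambda>n. sibuya_mass \<gamma> n * s ^ n) sums (1 - (1 - s) powr \<gamma>)"
      by (intro sibuya_mass_sums_open) auto
    then have "(\<Sum>n<N. sibuya_mass \<gamma> n * s ^ n) \<le> 1 - (1 - s) powr \<gamma>"
      using s sibuya_mass_nonneg[OF assms] sum_le_suminf[of "\<lambda>n. sibuya_mass \<gamma> n * s ^ n" "{..<N}"]
      by (auto simp: sums_iff)
    then show "(\<Sum>n<N. sibuya_mass \<gamma> n * s ^ n) \<le> 1"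
      using powr_ge_zero[of "1-s" \<gamma>] by linarith
  qed simp
  ultimately show "(\<Sum>n<N. sibuya_mass \<gamma> n) \<le> 1"
    using tendsto_upperbound by fastforce
qed (use sibuya_mass_nonneg[OF assms] in auto)

text \<open>
  The endpoints are needed: the step law below has characteristic function \<open>1\<close> at \<open>t = 0\<close>, and
  \<open>-1\<close> at \<open>t = pi\<close> if \<open>\<kappa> = 0\<close>. By the Weierstrass test both sides are continuous on
  \<open>{-1..1}\<close>, so the identity extends from the open interval.
\<close>
lemma sibuya_mass_sums:
  assumes "0 < \<gamma>" "\<gamma> \<le> 1" "\<bar>s\<bar> \<le> 1"
  shows "(\<lambda>n. sibuya_mass \<gamma> n * s ^ n) sums (1 - (1 - s) powr \<gamma>)"
proof -
  define f where "f s = (\<Sum>n. sibuya_mass \<gamma> n * s ^ n)" for s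
  have bound: "norm (sibuya_mass \<gamma> n * s ^ n) \<le> sibuya_mass \<gamma> n" if "s \<in> {-1..1}" for n s
    using that sibuya_mass_nonneg[OF assms(1,2), of n]
    by (auto simp: abs_mult power_abs intro!: mult_left_le power_le_one)
  have "uniform_limit {-1..1} (\<lambda>N s. \<Sum>n<N. sibuya_mass \<gamma> n * s ^ n) f sequentially"
    unfolding f_def using bound summable_sibuya_mass[OF assms(1,2)] by (rule Weierstrass_m_test)
  then have "continuous_on {-1..1} f"
    by (rule uniform_limit_theorem[rotated]) (auto intro!: always_eventually continuous_intros)
  moreover have "continuous_on {-1..1} (\<lambda>s. 1 - (1 - s) powr \<gamma>)"
    using assms by (intro continuous_intros continuous_on_powr') auto
  ultimately have cont: "continuous_on (closure {-1<..<1}) (\<lambda>s. f s - (1 - (1 - s) powr \<gamma>))"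
    by (auto intro: continuous_intros)
  have "f s - (1 - (1 - s) powr \<gamma>) = 0"
  proof (rule continuous_constant_on_closure[OF cont])
    show "f s - (1 - (1 - s) powr \<gamma>) = 0" if "s \<in> {-1<..<1}" for s
      using sibuya_mass_sums_open[of s \<gamma>] that by (auto simp: f_def sums_iff)
  qed (use assms in auto)
  moreover have "summable (\<lambda>n. sibuya_mass \<gamma> n * s ^ n)"
  proof (rule summable_comparison_test'[OF summable_sibuya_mass[OF assms(1,2)], of 0])
    show "norm (sibuya_mass \<gamma> n * s ^ n) \<le> sibuya_mass \<gamma> n" for n
      using assms(3) by (intro bound) auto
  qed
  ultimately show ?thesis by (simp add: f_def sums_iff)
qed

lemma sibuya_pgf:
  assumes "0 < \<gamma>" "\<gamma> \<le> 1"
  obtains q where "\<And>s. \<bar>s\<bar> \<le> 1 \<Longrightarrow> (\<lambda>n. pmf q n * s ^ n) sums (1 - (1 - s) powr \<gamma>)"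
proof
  have "(\<integral>\<^sup>+n. ennreal (sibuya_mass \<gamma> n) \<partial>count_space UNIV) = (\<Sum>n. ennreal (sibuya_mass \<gamma> n))"
    by (rule nn_integral_count_space_nat)
  also have "\<dots> = ennreal 1"
    using sibuya_mass_sums[OF assms, of 1] sibuya_mass_nonneg[OF assms] by (intro suminf_ennreal_eq) auto
  finally have "pmf (embed_pmf (sibuya_mass \<gamma>)) n = sibuya_mass \<gamma> n" for n
    using sibuya_mass_nonneg[OF assms] by (intro pmf_embed_pmf) auto
  then show "\<bar>s\<bar> \<le> 1 \<Longrightarrow> (\<lambda>n. pmf (embed_pmf (sibuya_mass \<gamma>)) n * s ^ n) sums (1 - (1 - s) powr \<gamma>)" for s
    using sibuya_mass_sums[OF assms, of s] by simp
qed

section \<open>Existence and characteristic function of the symmetric discrete stable law\<close>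

definition sds_step :: "real \<Rightarrow> int pmf" where
  "sds_step \<kappa> = bind_pmf (geometric_pmf (1 - \<kappa>)) (\<lambda>n. pmf_of_set {int (Suc n), - int (Suc n)})"

definition sds_exponent :: "real \<Rightarrow> real \<Rightarrow> real" where
  "sds_exponent \<kappa> t = ((1 - cos t) * (1 + \<kappa>)) / (\<kappa>\<^sup>2 - 2 * \<kappa> * cos t + 1)"

lemma sds_denominator_ge:
  fixes \<kappa> t :: real
  assumes "0 \<le> \<kappa>"
  shows "(1 - \<kappa>)\<^sup>2 \<le> \<kappa>\<^sup>2 - 2 * \<kappa> * cos t + 1"
  using mult_left_mono[of "cos t" 1 \<kappa>] assms by (simp add: power2_eq_square algebra_simps)

lemma sds_denominator_pos:
  fixes \<kappa> t :: real
  assumes "0 \<le> \<kappa>" "\<kappa> < 1"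
  shows "0 < \<kappa>\<^sup>2 - 2 * \<kappa> * cos t + 1"
proof -
  have "0 < (1 - \<kappa>)\<^sup>2" using assms by simp
  then show ?thesis using sds_denominator_ge[OF assms(1), of t] by linarith
qed

text \<open>
  The step equals \<open>n + 1\<close> up to a fair sign, so its characteristic function is the series
  \<open>(1 - \<kappa>) * (\<Sum>n. \<kappa> ^ n * cos ((n + 1) * t))\<close>. It is the real part of a geometric series in
  \<open>\<kappa> * exp (\<i> * t)\<close>, and its sum \<open>(1 - \<kappa>) * (cos t - \<kappa>) / (\<kappa>\<^sup>2 - 2 * \<kappa> * cos t + 1)\<close> is one minus the
  exponent.
\<close>
lemma int_char_sds_step:
  assumes "0 \<le> \<kappa>" "\<kappa> < 1"
  shows "int_char (sds_step \<kappa>) t = complex_of_real (1 - sds_exponent \<kappa> t)"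
proof -
  have pair: "int_char (pmf_of_set {int (Suc n), - int (Suc n)}) t = complex_of_real (cos (real (Suc n) * t))" for n
  proof -
    have card: "card {int (Suc n), - int (Suc n)} = 2" by (simp add: card_insert_if)
    have ne: "int (Suc n) \<noteq> - int (Suc n)" by simp
    have "int_char (pmf_of_set {int (Suc n), - int (Suc n)}) t
        = (iexp (real (Suc n) * t) + iexp (- (real (Suc n) * t))) / 2"
      using ne unfolding int_char_eq
      by (subst integral_measure_pmf[of "{int (Suc n), - int (Suc n)}"])
         (simp_all add: mult.commute card scaleR_conv_of_real add_divide_distrib del: of_nat_Suc)
    also have "\<dots> = complex_of_real (cos (real (Suc n) * t))"
      by (simp add: cos_exp_eq flip: cos_of_real del: of_nat_Suc of_real_mult)
    finally show ?thesis .
  qed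
  define w where "w = iexp t"
  have w: "norm (complex_of_real \<kappa> * w) < 1" using assms by (simp add: w_def norm_mult)
  have "(\<lambda>n. (complex_of_real \<kappa> * w) ^ n) sums (1 / (1 - complex_of_real \<kappa> * w))"
    using w by (rule geometric_sums)
  then have "(\<lambda>n. (1 - \<kappa>) * Re (w * (complex_of_real \<kappa> * w) ^ n)) sums ((1 - \<kappa>) * Re (w * (1 / (1 - complex_of_real \<kappa> * w))))"
    by (intro sums_mult sums_Re)
  moreover have "Re (w * (complex_of_real \<kappa> * w) ^ n) = \<kappa> ^ n * cos (real (Suc n) * t)" for n
  proof -
    have "w * (complex_of_real \<kappa> * w) ^ n = of_real (\<kappa> ^ n) * w ^ Suc n" by (simp add: power_mult_distrib)
    also have "w ^ Suc n = iexp (real (Suc n) * t)"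
      unfolding w_def by (subst exp_of_nat_mult[symmetric]) (simp add: algebra_simps)
    finally show ?thesis by (simp add: Re_exp del: of_nat_Suc)
  qed
  moreover have "(1 - \<kappa>) * Re (w * (1 / (1 - complex_of_real \<kappa> * w))) = 1 - sds_exponent \<kappa> t"
  proof -
    define D where "D = \<kappa>\<^sup>2 - 2 * \<kappa> * cos t + 1"
    have D: "D > 0" using sds_denominator_pos[OF assms, of t] by (simp add: D_def)
    have wRe: "Re w = cos t" "Im w = sin t" by (auto simp: w_def Re_exp Im_exp)
    have "(1 - \<kappa> * cos t)\<^sup>2 + (\<kappa> * sin t)\<^sup>2 = 1 - 2 * \<kappa> * cos t + \<kappa>\<^sup>2 * ((sin t)\<^sup>2 + (cos t)\<^sup>2)"
      by (simp add: power2_eq_square algebra_simps del: sin_cos_squared_add sin_cos_squared_add2 sin_cos_squared_add3)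
    then have D': "(1 - \<kappa> * cos t)\<^sup>2 + (\<kappa> * sin t)\<^sup>2 = D"
      by (simp add: D_def)
    have "Re (w * (1 / (1 - complex_of_real \<kappa> * w))) = (cos t * (1 - \<kappa> * cos t) - sin t * (\<kappa> * sin t)) / D"
      by (simp add: Re_divide wRe D')
    also have "cos t * (1 - \<kappa> * cos t) - sin t * (\<kappa> * sin t) = cos t - \<kappa> * ((sin t)\<^sup>2 + (cos t)\<^sup>2)"
      by (simp add: power2_eq_square algebra_simps del: sin_cos_squared_add sin_cos_squared_add2 sin_cos_squared_add3)
    finally have "Re (w * (1 / (1 - complex_of_real \<kappa> * w))) = (cos t - \<kappa>) / D"
      by simp
    moreover have "(1 - \<kappa>) * (cos t - \<kappa>) = D - (1 - cos t) * (1 + \<kappa>)"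
      by (simp add: D_def power2_eq_square algebra_simps)
    ultimately show ?thesis
      using D unfolding sds_exponent_def D_def[symmetric]
      by (simp only: times_divide_eq_right) (simp add: diff_divide_distrib)
  qed
  ultimately have sums: "(\<lambda>n. (1 - \<kappa>) * (\<kappa> ^ n * cos (real (Suc n) * t))) sums (1 - sds_exponent \<kappa> t)"
    by simp
  have "int_char (sds_step \<kappa>) t = complex_of_real (\<integral>n. cos (real (Suc n) * t) \<partial>geometric_pmf (1 - \<kappa>))"
    unfolding sds_step_def int_char_bind_pmf pair by simp
  also have "(\<integral>n. cos (real (Suc n) * t) \<partial>geometric_pmf (1 - \<kappa>)) = 1 - sds_exponent \<kappa> t"
  proof (rule expectation_nat_pmf_sums[where B = 1])
    show "(\<lambda>n. pmf (geometric_pmf (1 - \<kappa>)) n * cos (real (Suc n) * t)) sums (1 - sds_exponent \<kappa> t)"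
      using sums assms by (simp add: mult_ac del: of_nat_Suc)
  qed simp
  finally show ?thesis .
qed

lemma abs_one_minus_sds_exponent_le:
  assumes "0 \<le> \<kappa>" "\<kappa> < 1"
  shows "\<bar>1 - sds_exponent \<kappa> t\<bar> \<le> 1"
  using real_distribution.cmod_char_le_1[OF real_distribution_int_pmf, of "sds_step \<kappa>" t]
  unfolding int_char_sds_step[OF assms] norm_of_real .

text \<open>
  A compound Poisson law whose jumps are Sibuya-distributed sums of steps: the inner generating
  function raises the exponent to the power \<open>\<gamma>\<close>, the outer one exponentiates.
\<close>
lemma exists_sds_pmf:
  assumes "0 < \<gamma>" "\<gamma> \<le> 1" "0 < lam" "0 \<le> \<kappa>" "\<kappa> < 1"
  obtains p where "\<And>t. int_char p t = complex_of_real (sds_cf \<gamma> lam \<kappa> t)"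
proof -
  obtain q where q: "\<And>s. \<bar>s\<bar> \<le> 1 \<Longrightarrow> (\<lambda>n. pmf q n * s ^ n) sums (1 - (1 - s) powr \<gamma>)"
    using sibuya_pgf[OF assms(1,2)] by blast
  let ?r = "bind_pmf q (iid_sum_pmf (sds_step \<kappa>))"
  have "int_char ?r t = complex_of_real (1 - sds_exponent \<kappa> t powr \<gamma>)" for t
    using int_char_random_sum[OF int_char_sds_step[OF assms(4,5)] q[OF abs_one_minus_sds_exponent_le[OF assms(4,5)]]]
    by simp
  from int_char_random_sum[OF this poisson_pgf[OF assms(3)]]
  have "int_char (bind_pmf (poisson_pmf lam) (iid_sum_pmf ?r)) t = complex_of_real (sds_cf \<gamma> lam \<kappa> t)" for t
    by (simp add: sds_cf_def sds_exponent_def)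
  then show ?thesis by (rule that)
qed

lemma int_char_inject:
  assumes "\<And>t. int_char p t = int_char p' t"
  shows "p = p'"
proof -
  have "distr (measure_pmf p) borel real_of_int = distr (measure_pmf p') borel real_of_int"
    by (rule Levy_uniqueness[OF real_distribution_int_pmf real_distribution_int_pmf]) (use assms in auto)
  then have eq: "measure (distr (measure_pmf p) borel real_of_int) {real_of_int k} =
      measure (distr (measure_pmf p') borel real_of_int) {real_of_int k}" for k by simp
  have "real_of_int -` {real_of_int k} = {k}" for k by auto
  then have "pmf p k = pmf p' k" for k
    using eq[of k] by (simp add: measure_distr measure_pmf_single)
  then show ?thesis by (rule pmf_eqI)
qed

text \<open>Reflection conjugates the characteristic function, which leaves a real one unchanged.\<close>
lemma pmf_symmetric_of_real_char:
  assumes "\<And>t. int_char p t = complex_of_real (g t)"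
  shows "pmf p (- k) = pmf p k"
proof -
  have "int_char (map_pmf uminus p) t = int_char p t" for t
  proof -
    have "int_char (map_pmf uminus p) t = cnj (int_char p t)"
    proof -
      have "iexp (t * real_of_int (- k)) = cnj (iexp (t * real_of_int k))" for k
        by (simp add: exp_cnj)
      then show ?thesis by (simp add: int_char_eq del: of_int_minus)
    qed
    then show ?thesis by (simp add: assms)
  qed
  then have "map_pmf uminus p = p" by (rule int_char_inject)
  then have "pmf p (- k) = pmf (map_pmf uminus p) (- k)" by simp
  also have "\<dots> = pmf p k" by (rule pmf_map_inj') (simp add: inj_def)
  finally show ?thesis .
qed

lemma int_char_SDS:
  assumes "0 < \<gamma>" "\<gamma> \<le> 1" "0 < lam" "0 \<le> \<kappa>" "\<kappa> < 1"
  shows "int_char (SDS \<gamma> lam \<kappa>) t = complex_of_real (sds_cf \<gamma> lam \<kappa> t)"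
proof -
  obtain p where p: "\<And>t. int_char p t = complex_of_real (sds_cf \<gamma> lam \<kappa> t)"
    using exists_sds_pmf[OF assms] by blast
  have "SDS \<gamma> lam \<kappa> = p"
    unfolding SDS_def
    by (rule the_equality) (use p in \<open>auto intro: pmf_symmetric_of_real_char int_char_inject\<close>)
  then show ?thesis by (simp add: p)
qed

section \<open>Tightness from a bound on characteristic functions\<close>

text \<open>
  Averaging \<open>cos (u * z * x)\<close> over a standard normal \<open>z\<close> gives the Gaussian characteristic
  function at \<open>u * x\<close>; Fubini's theorem does the rest. Averaging over a Gaussian instead of an
  interval gives a kernel \<open>1 - exp (- (u * x)\<^sup>2 / 2)\<close> that is visibly bounded away from \<open>0\<close> in
  the tails.
\<close>
lemma gaussian_average_char:
  assumes "real_distribution M"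
  shows "(\<integral>z. 1 - Re (char M (u * z)) \<partial>std_normal_distribution)
           = (\<integral>x. 1 - exp (- (u * x)\<^sup>2 / 2) \<partial>M)"
proof -
  interpret M: real_distribution M by fact
  interpret N: real_distribution std_normal_distribution by (rule real_dist_normal_dist)
  interpret P: pair_prob_space M std_normal_distribution ..
  have Re_char: "Re (char K t) = (\<integral>x. cos (t * x) \<partial>K)" if "real_distribution K" for K t
  proof -
    interpret K: real_distribution K by fact
    have "integrable K (\<lambda>x. iexp (t * x))" by (rule K.integrable_const_bound[where B = 1]) auto
    then have "Re (char K t) = (\<integral>x. Re (iexp (t * x)) \<partial>K)"
      unfolding char_def by (rule integral_Re[symmetric])
    then show ?thesis by (simp add: Re_exp)
  qed
  have int: "integrable (M \<Otimes>\<^sub>M std_normal_distribution) (\<lambda>(x, z). cos (u * z * x))"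
    by (rule P.integrable_const_bound[where B = 1]) auto
  have "(\<integral>z. Re (char M (u * z)) \<partial>std_normal_distribution)
      = (\<integral>z. (\<integral>x. cos (u * z * x) \<partial>M) \<partial>std_normal_distribution)"
    by (simp add: Re_char[OF assms])
  also have "\<dots> = (\<integral>x. (\<integral>z. cos (u * z * x) \<partial>std_normal_distribution) \<partial>M)"
    by (rule P.Fubini_integral[OF int])
  also have "(\<lambda>x. \<integral>z. cos (u * z * x) \<partial>std_normal_distribution) = (\<lambda>x. exp (- (u * x)\<^sup>2 / 2))"
  proof
    fix x
    show "(\<integral>z. cos (u * z * x) \<partial>std_normal_distribution) = exp (- (u * x)\<^sup>2 / 2)"
      using Re_char[OF real_dist_normal_dist, of "u * x"]
      by (simp only: char_std_normal_distribution Re_complex_of_real) (simp add: mult_ac)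
  qed
  finally have eq: "(\<integral>z. Re (char M (u * z)) \<partial>std_normal_distribution) = (\<integral>x. exp (- (u * x)\<^sup>2 / 2) \<partial>M)" .
  have "norm (Re (char M t)) \<le> 1" for t
    using M.cmod_char_le_1[of t] abs_Re_le_cmod[of "char M t"] by simp
  then have "integrable std_normal_distribution (\<lambda>z. Re (char M (u * z)))"
    by (intro N.integrable_const_bound[where B = 1]) auto
  moreover have "integrable M (\<lambda>x. exp (- (u * x)\<^sup>2 / 2))"
    by (intro M.integrable_const_bound[where B = 1]) auto
  ultimately show ?thesis
    using eq M.prob_space N.prob_space by (simp del: space_density)
qed

lemma powr_le_one_plus_square:
  fixes z :: real
  assumes "0 < \<alpha>" "\<alpha> \<le> 2"
  shows "\<bar>z\<bar> powr \<alpha> \<le> 1 + z\<^sup>2"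
proof (cases "\<bar>z\<bar> \<le> 1")
  case True
  then have "\<bar>z\<bar> powr \<alpha> \<le> 1" using assms by (intro powr_le1) auto
  then show ?thesis using zero_le_power2[of z] by linarith
next
  case False
  then have "\<bar>z\<bar> powr \<alpha> \<le> \<bar>z\<bar> powr 2" using assms by (intro powr_mono) auto
  then show ?thesis using False by simp
qed

text \<open>
  On \<open>1 / u \<le> \<bar>x\<bar>\<close> the Gaussian kernel is at least \<open>1 - exp (- 1 / 2)\<close>. The average of
  \<open>\<bar>u * z\<bar> powr \<alpha>\<close> is at most that of \<open>u powr \<alpha> * (1 + z\<^sup>2)\<close>, and the second moment is \<open>1\<close>;
  hence the factor \<open>2\<close>.
\<close>
lemma tail_bound_of_char_bound:
  assumes "real_distribution M" "0 < \<alpha>" "\<alpha> \<le> 2" "0 < u"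
    and "\<And>t. 1 - Re (char M t) \<le> C * \<bar>t\<bar> powr \<alpha>"
  shows "measure M {x. 1 / u \<le> \<bar>x\<bar>} * (1 - exp (- (1 / 2))) \<le> 2 * C * u powr \<alpha>"
proof -
  interpret M: real_distribution M by fact
  interpret N: real_distribution std_normal_distribution by (rule real_dist_normal_dist)
  have Re_le: "Re (char M t) \<le> 1" "norm (Re (char M t)) \<le> 1" for t
    using M.cmod_char_le_1[of t] abs_Re_le_cmod[of "char M t"] by simp_all
  have C: "0 \<le> C" using assms(5)[of 1] Re_le(1)[of 1] by simp
  have moment: "integrable std_normal_distribution (\<lambda>z. z\<^sup>2)" "(\<integral>z. z\<^sup>2 \<partial>std_normal_distribution) = 1"
    using std_normal_distribution_even_moments[of 1] by simp_all
  have "measure M {x. 1 / u \<le> \<bar>x\<bar>} * (1 - exp (- (1 / 2)))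
      = (\<integral>x. indicator {x. 1 / u \<le> \<bar>x\<bar>} x * (1 - exp (- (1 / 2))) \<partial>M)"
    by simp
  also have "\<dots> \<le> (\<integral>x. 1 - exp (- (u * x)\<^sup>2 / 2) \<partial>M)"
  proof (rule integral_mono)
    show "integrable M (\<lambda>x. 1 - exp (- (u * x)\<^sup>2 / 2))"
      by (rule M.integrable_const_bound[where B = 1]) auto
    fix x
    show "indicator {x. 1 / u \<le> \<bar>x\<bar>} x * (1 - exp (- (1 / 2))) \<le> 1 - exp (- (u * x)\<^sup>2 / 2)"
    proof (cases "1 / u \<le> \<bar>x\<bar>")
      case True
      then have "1 \<le> \<bar>u * x\<bar>" using assms(4) by (simp add: abs_mult field_simps)
      then have "1 \<le> (u * x)\<^sup>2" by (metis one_le_power power2_abs)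
      then show ?thesis using True by simp
    qed simp
  qed (auto simp: M.emeasure_eq_measure intro!: integrable_mult_left)
  also have "\<dots> = (\<integral>z. 1 - Re (char M (u * z)) \<partial>std_normal_distribution)"
    by (rule gaussian_average_char[OF assms(1), symmetric])
  also have "\<dots> \<le> (\<integral>z. C * u powr \<alpha> * (1 + z\<^sup>2) \<partial>std_normal_distribution)"
  proof (rule integral_mono)
    show "integrable std_normal_distribution (\<lambda>z. 1 - Re (char M (u * z)))"
      using Re_le by (intro Bochner_Integration.integrable_diff N.integrable_const_bound[where B = 1]) auto
    show "integrable std_normal_distribution (\<lambda>z. C * u powr \<alpha> * (1 + z\<^sup>2))"
      using moment by (intro integrable_mult_right Bochner_Integration.integrable_add) auto
    fix z
    have "1 - Re (char M (u * z)) \<le> C * (u powr \<alpha> * \<bar>z\<bar> powr \<alpha>)"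
      using assms(5)[of "u * z"] assms(4) by (simp add: abs_mult powr_mult)
    also have "\<dots> \<le> C * (u powr \<alpha> * (1 + z\<^sup>2))"
      using C powr_le_one_plus_square[OF assms(2,3)] by (intro mult_left_mono) auto
    finally show "1 - Re (char M (u * z)) \<le> C * u powr \<alpha> * (1 + z\<^sup>2)" by (simp add: mult.assoc)
  qed
  also have "\<dots> = 2 * C * u powr \<alpha>"
    using moment N.prob_space by (simp del: space_density)
  finally show ?thesis .
qed

text \<open>The tail bound is uniform in \<open>n\<close> and tends to \<open>0\<close> with \<open>u\<close>.\<close>
lemma tight_of_char_bound:
  assumes "\<And>n. real_distribution (\<mu> n)" "0 < \<alpha>" "\<alpha> \<le> 2"
    and bound: "\<And>n t. 1 - Re (char (\<mu> n) t) \<le> C * \<bar>t\<bar> powr \<alpha>"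
  shows "tight \<mu>"
  unfolding tight_def
proof (intro conjI allI impI)
  show "real_distribution (\<mu> n)" for n by (rule assms(1))
next
  fix \<epsilon> :: real assume \<epsilon>: "0 < \<epsilon>"
  interpret \<mu>: real_distribution "\<mu> n" for n by fact
  have C: "0 \<le> C"
    using bound[of 0 1] \<mu>.cmod_char_le_1[of 0 1] complex_Re_le_cmod[of "char (\<mu> 0) 1"] by simp
  define \<delta> :: real where "\<delta> = 1 - exp (- (1 / 2))"
  have \<delta>: "0 < \<delta>" by (simp add: \<delta>_def)
  (* Chosen so that the tail bound 2 * C * u powr \<alpha> / \<delta> falls below \<epsilon>; the denominator
     2 * C + 1 also covers C = 0. *)
  define u where "u = (\<epsilon> * \<delta> / (2 * C + 1)) powr (1 / \<alpha>)"
  have u: "0 < u" using \<epsilon> \<delta> C unfolding u_def by simp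
  have u\<alpha>: "u powr \<alpha> = \<epsilon> * \<delta> / (2 * C + 1)"
    using \<epsilon> \<delta> C assms(2) by (simp add: u_def powr_powr)
  show "\<exists>a b. a < b \<and> (\<forall>n. 1 - \<epsilon> < measure (\<mu> n) {a<..b})"
  proof (intro exI conjI allI)
    have "0 < 1 / u" using u by simp
    then show "- (1 / u) < 1 / u" by linarith
    fix n
    have "measure (\<mu> n) {x. 1 / u \<le> \<bar>x\<bar>} * \<delta> \<le> 2 * C * u powr \<alpha>"
      unfolding \<delta>_def by (rule tail_bound_of_char_bound[OF assms(1-3) u bound])
    also have "\<dots> = \<epsilon> * \<delta> * (2 * C / (2 * C + 1))"
      by (simp add: u\<alpha>)
    also have "\<dots> < \<epsilon> * \<delta> * 1"
      using \<epsilon> \<delta> C by (intro mult_strict_left_mono) simp_all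
    finally have "measure (\<mu> n) {x. 1 / u \<le> \<bar>x\<bar>} < \<epsilon>"
      using \<delta> by simp
    moreover have "1 - measure (\<mu> n) {x. 1 / u \<le> \<bar>x\<bar>} = measure (\<mu> n) (space (\<mu> n) - {x. 1 / u \<le> \<bar>x\<bar>})"
      by (rule \<mu>.prob_compl[symmetric]) simp
    moreover have "\<dots> \<le> measure (\<mu> n) {- (1 / u)<..1 / u}"
      by (rule \<mu>.finite_measure_mono) (auto simp: not_le abs_less_iff)
    ultimately show "1 - \<epsilon> < measure (\<mu> n) {- (1 / u)<..1 / u}" by linarith
  qed
qed

text \<open>
  Levy's continuity theorem with the limit law as output: tightness provides a limit along a
  subsequence, and pointwise convergence identifies its characteristic function.
\<close>
lemma exists_distribution_of_char_limit:
  assumes "\<And>n. real_distribution (\<mu> n)" "0 < \<alpha>" "\<alpha> \<le> 2"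
    and "\<And>n t. 1 - Re (char (\<mu> n) t) \<le> C * \<bar>t\<bar> powr \<alpha>"
    and lim: "\<And>t. (\<lambda>n. char (\<mu> n) t) \<longlonglongrightarrow> g t"
  obtains L where "real_distribution L" "\<And>t. char L t = g t"
proof -
  have "tight \<mu>" by (rule tight_of_char_bound[OF assms(1-4)])
  from tight_imp_convergent_subsubsequence[OF this strict_mono_id]
  obtain r L where r: "strict_mono (r :: nat \<Rightarrow> nat)" and L: "real_distribution L"
    and conv: "weak_conv_m (\<mu> \<circ> id \<circ> r) L"
    by blast
  have "char L t = g t" for t
  proof (rule LIMSEQ_unique)
    show "(\<lambda>n. char (\<mu> (r n)) t) \<longlonglongrightarrow> char L t"
      using levy_continuity1[OF _ L conv, of t] assms(1) by (simp add: o_def)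
    show "(\<lambda>n. char (\<mu> (r n)) t) \<longlonglongrightarrow> g t"
      using LIMSEQ_subseq_LIMSEQ[OF lim r] by (simp add: o_def)
  qed
  with L show ?thesis by (rule that)
qed

section \<open>Symmetric stable laws\<close>

lemma char_distr_mult:
  assumes "real_distribution L"
  shows "char (distr L borel (\<lambda>x. a * x)) t = char L (a * t)"
proof -
  interpret L: real_distribution L by fact
  show ?thesis by (simp add: char_def integral_distr mult_ac)
qed

lemma char_distr_linear_combination:
  assumes "real_distribution L"
  shows "char (distr (L \<Otimes>\<^sub>M L) borel (\<lambda>(x, y). a * x + b * y)) t = char L (a * t) * char L (b * t)"
proof -
  interpret L: real_distribution L by fact
  interpret P: pair_prob_space L L ..
  have int: "integrable (L \<Otimes>\<^sub>M L) (\<lambda>(x, y). iexp (a * t * x) * iexp (b * t * y))"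
    by (rule P.integrable_const_bound[where B = 1]) (auto simp: norm_mult)
  have "char (distr (L \<Otimes>\<^sub>M L) borel (\<lambda>(x, y). a * x + b * y)) t
      = (\<integral>p. iexp (t * (case p of (x, y) \<Rightarrow> a * x + b * y)) \<partial>(L \<Otimes>\<^sub>M L))"
    unfolding char_def by (rule integral_distr) auto
  also have "\<dots> = (\<integral>p. (case p of (x, y) \<Rightarrow> iexp (a * t * x) * iexp (b * t * y)) \<partial>(L \<Otimes>\<^sub>M L))"
    by (rule Bochner_Integration.integral_cong)
       (auto simp: algebra_simps simp flip: exp_add)
  also have "\<dots> = (\<integral>x. (\<integral>y. iexp (a * t * x) * iexp (b * t * y) \<partial>L) \<partial>L)"
    using P.integral_fst'[OF int] by simp
  also have "\<dots> = char L (a * t) * char L (b * t)"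
    by (simp add: char_def)
  finally show ?thesis .
qed

text \<open>
  All conditions are read off from the characteristic function: it is even; its modulus at \<open>1\<close> is
  less than \<open>1\<close>, unlike for a point mass; and \<open>\<bar>s * t\<bar> powr \<alpha> = \<bar>a * t\<bar> powr \<alpha> + \<bar>b * t\<bar> powr \<alpha>\<close>
  for the scale \<open>s\<close> in the definition of stability.
\<close>
lemma symmetric_stable_of_char:
  assumes L: "real_distribution L" and "0 < \<alpha>" "0 < c"
    and char_L: "\<And>t. char L t = complex_of_real (exp (- c * \<bar>t\<bar> powr \<alpha>))"
  shows "symmetric_stable \<alpha> L"
  unfolding symmetric_stable_def
proof (intro conjI allI impI)
  interpret L: real_distribution L by fact
  interpret P: pair_prob_space L L ..
  show "real_distribution L" by fact
  have "char (distr L borel (\<lambda>x. - 1 * x)) = char L"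
    unfolding char_distr_mult[OF L] fun_eq_iff char_L by simp
  then have "distr L borel (\<lambda>x. - 1 * x) = L"
    by (intro Levy_uniqueness L.real_distribution_distr L) auto
  then show "distr L borel uminus = L" by simp
  show "L \<noteq> return borel x" for x
  proof
    assume "L = return borel x"
    then have "norm (char L 1) = 1"
      by (simp add: char_def integral_return)
    then show False using assms(3) by (simp add: char_L)
  qed
  fix a b :: real assume ab: "0 < a" "0 < b"
  define s where "s = (a powr \<alpha> + b powr \<alpha>) powr (1 / \<alpha>)"
  have s: "\<bar>s * t\<bar> powr \<alpha> = \<bar>a * t\<bar> powr \<alpha> + \<bar>b * t\<bar> powr \<alpha>" for t
    using ab assms(2) by (simp add: s_def abs_mult powr_mult powr_powr distrib_right add_pos_pos)
  have meas: "(\<lambda>(x, y). a * x + b * y) \<in> borel_measurable (L \<Otimes>\<^sub>M L)" by measurable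
  have "char (distr (L \<Otimes>\<^sub>M L) borel (\<lambda>(x, y). a * x + b * y)) = char (distr L borel (\<lambda>x. s * x))"
    unfolding char_distr_mult[OF L] char_distr_linear_combination[OF L] fun_eq_iff char_L s
    by (simp add: distrib_left right_diff_distrib flip: of_real_mult exp_add)
  then show "distr (L \<Otimes>\<^sub>M L) borel (\<lambda>(x, y). a * x + b * y)
      = distr L borel (\<lambda>x. (a powr \<alpha> + b powr \<alpha>) powr (1 / \<alpha>) * x)"
    unfolding s_def by (intro Levy_uniqueness P.real_distribution_distr L.real_distribution_distr meas) auto
qed

section \<open>Asymptotics of the exponent\<close>

lemma sds_exponent_nonneg:
  assumes "0 \<le> \<kappa>" "\<kappa> < 1"
  shows "0 \<le> sds_exponent \<kappa> s"
  using abs_one_minus_sds_exponent_le[OF assms, of s] by simp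

text \<open>
  The numerator is at most its quadratic Taylor term and the denominator is smallest at \<open>0\<close>, so
  the constant is the same as in the asymptotics at \<open>0\<close>.
\<close>
lemma sds_exponent_le:
  assumes "0 \<le> \<kappa>" "\<kappa> < 1"
  shows "sds_exponent \<kappa> s \<le> (1 + \<kappa>) / (2 * (1 - \<kappa>)\<^sup>2) * s\<^sup>2"
proof -
  have "1 - cos s = 2 * (sin (s / 2))\<^sup>2" using cos_double_sin[of "s / 2"] by simp
  also have "\<dots> \<le> 2 * (s / 2)\<^sup>2"
    using abs_sin_x_le_abs_x[of "s / 2"] by (intro mult_left_mono abs_le_square_iff[THEN iffD1]) auto
  finally have "1 - cos s \<le> s\<^sup>2 / 2" by (simp add: power_divide)
  then have "sds_exponent \<kappa> s \<le> (s\<^sup>2 / 2 * (1 + \<kappa>)) / (1 - \<kappa>)\<^sup>2"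
    unfolding sds_exponent_def using assms sds_denominator_ge[OF assms(1), of s]
    by (intro frac_le mult_right_mono) auto
  then show ?thesis by (simp add: field_simps)
qed

lemma sds_exponent_asymp:
  assumes "0 \<le> \<kappa>" "\<kappa> < 1"
  shows "((\<lambda>s. sds_exponent \<kappa> s / s\<^sup>2) \<longlongrightarrow> (1 + \<kappa>) / (2 * (1 - \<kappa>)\<^sup>2)) (at 0)"
proof -
  have sinc: "((\<lambda>s. sin (s / 2) / s) \<longlongrightarrow> 1 / 2) (at (0::real))"
  proof -
    have "((\<lambda>s. sin (s / 2)) has_real_derivative 1 / 2) (at 0)"
      by (auto intro!: derivative_eq_intros)
    then show ?thesis by (simp add: DERIV_def)
  qed
  have "((\<lambda>s. 2 * (sin (s / 2) / s)\<^sup>2 * ((1 + \<kappa>) / (\<kappa>\<^sup>2 - 2 * \<kappa> * cos s + 1)))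
      \<longlongrightarrow> 2 * (1 / 2)\<^sup>2 * ((1 + \<kappa>) / (\<kappa>\<^sup>2 - 2 * \<kappa> * cos 0 + 1))) (at 0)"
    using sds_denominator_pos[OF assms, of 0]
    by (intro tendsto_mult[OF tendsto_mult[OF tendsto_const tendsto_power[OF sinc]]] tendsto_intros) auto
  also have "2 * (1 / 2)\<^sup>2 * ((1 + \<kappa>) / (\<kappa>\<^sup>2 - 2 * \<kappa> * cos 0 + 1)) = (1 + \<kappa>) / (2 * (1 - \<kappa>)\<^sup>2)"
    by (simp add: power2_eq_square algebra_simps)
  also have "(\<lambda>s. 2 * (sin (s / 2) / s)\<^sup>2 * ((1 + \<kappa>) / (\<kappa>\<^sup>2 - 2 * \<kappa> * cos s + 1))) = (\<lambda>s. sds_exponent \<kappa> s / s\<^sup>2)"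
  proof
    fix s :: real
    have "1 - cos s = 2 * (sin (s / 2))\<^sup>2" using cos_double_sin[of "s / 2"] by simp
    then show "2 * (sin (s / 2) / s)\<^sup>2 * ((1 + \<kappa>) / (\<kappa>\<^sup>2 - 2 * \<kappa> * cos s + 1)) = sds_exponent \<kappa> s / s\<^sup>2"
      by (simp add: sds_exponent_def power_divide)
  qed
  finally show ?thesis .
qed

text \<open>The normalisation \<open>n powr (- 1 / (2 * \<gamma>))\<close> exactly absorbs the factor \<open>n\<close>.\<close>
lemma scaled_square_powr:
  fixes x t \<gamma> :: real
  assumes "0 < \<gamma>" "0 < n" "0 \<le> x"
  shows "real n * (x * (real n powr (- 1 / (2 * \<gamma>)) * t)\<^sup>2) powr \<gamma> = x powr \<gamma> * \<bar>t\<bar> powr (2 * \<gamma>)"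
proof -
  have sq: "y\<^sup>2 powr \<gamma> = \<bar>y\<bar> powr (2 * \<gamma>)" for y :: real
  proof -
    have "\<bar>y\<bar> powr (2 * \<gamma>) = (\<bar>y\<bar> powr 2) powr \<gamma>" by (simp only: powr_powr)
    then show ?thesis by simp
  qed
  have "(x * (real n powr (- 1 / (2 * \<gamma>)) * t)\<^sup>2) powr \<gamma>
      = x powr \<gamma> * ((real n powr (- 1 / (2 * \<gamma>))) powr (2 * \<gamma>) * \<bar>t\<bar> powr (2 * \<gamma>))"
    using assms(3) by (simp add: powr_mult sq abs_mult del: powr_powr)
  also have "(real n powr (- 1 / (2 * \<gamma>))) powr (2 * \<gamma>) = 1 / real n"
    using assms by (simp only: powr_powr) (simp add: powr_minus_divide)
  finally show ?thesis using assms(2) by simp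
qed

lemma scaled_sds_exponent_le:
  assumes "0 < \<gamma>" "0 \<le> \<kappa>" "\<kappa> < 1"
  shows "real n * sds_exponent \<kappa> (real n powr (- 1 / (2 * \<gamma>)) * t) powr \<gamma>
           \<le> ((1 + \<kappa>) / (2 * (1 - \<kappa>)\<^sup>2)) powr \<gamma> * \<bar>t\<bar> powr (2 * \<gamma>)"
proof (cases "n = 0")
  case False
  have "real n * sds_exponent \<kappa> (real n powr (- 1 / (2 * \<gamma>)) * t) powr \<gamma>
      \<le> real n * ((1 + \<kappa>) / (2 * (1 - \<kappa>)\<^sup>2) * (real n powr (- 1 / (2 * \<gamma>)) * t)\<^sup>2) powr \<gamma>"
    using assms by (intro mult_left_mono powr_mono2 sds_exponent_le sds_exponent_nonneg) auto
  also have "\<dots> = ((1 + \<kappa>) / (2 * (1 - \<kappa>)\<^sup>2)) powr \<gamma> * \<bar>t\<bar> powr (2 * \<gamma>)"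
    using assms False by (intro scaled_square_powr) auto
  finally show ?thesis .
qed simp

lemma scaled_sds_exponent_tendsto:
  assumes "0 < \<gamma>" "0 \<le> \<kappa>" "\<kappa> < 1"
  shows "(\<lambda>n. real n * sds_exponent \<kappa> (real n powr (- 1 / (2 * \<gamma>)) * t) powr \<gamma>)
           \<longlonglongrightarrow> ((1 + \<kappa>) / (2 * (1 - \<kappa>)\<^sup>2)) powr \<gamma> * \<bar>t\<bar> powr (2 * \<gamma>)"
proof (cases "t = 0")
  case True
  then show ?thesis by (simp add: sds_exponent_def)
next
  case False
  define s where "s n = real n powr (- 1 / (2 * \<gamma>)) * t" for n
  have "(\<lambda>n. real n powr (- 1 / (2 * \<gamma>)) * t) \<longlonglongrightarrow> 0 * t"
    using assms by (intro tendsto_intros tendsto_neg_powr filterlim_real_sequentially) auto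
  then have "s \<longlonglongrightarrow> 0" by (simp only: s_def[abs_def] mult_zero_left)
  moreover have "\<forall>\<^sub>F n in sequentially. s n \<noteq> 0"
    using eventually_gt_at_top[of 0] by eventually_elim (use False in \<open>simp add: s_def\<close>)
  ultimately have "filterlim s (at 0) sequentially" by (simp add: filterlim_at)
  then have "(\<lambda>n. sds_exponent \<kappa> (s n) / (s n)\<^sup>2) \<longlonglongrightarrow> (1 + \<kappa>) / (2 * (1 - \<kappa>)\<^sup>2)"
    by (rule filterlim_compose[OF sds_exponent_asymp[OF assms(2,3)]])
  then have "(\<lambda>n. (sds_exponent \<kappa> (s n) / (s n)\<^sup>2) powr \<gamma> * \<bar>t\<bar> powr (2 * \<gamma>))
      \<longlonglongrightarrow> ((1 + \<kappa>) / (2 * (1 - \<kappa>)\<^sup>2)) powr \<gamma> * \<bar>t\<bar> powr (2 * \<gamma>)"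
    using assms by (intro tendsto_mult tendsto_powr tendsto_const) auto
  moreover have "\<forall>\<^sub>F n in sequentially. (sds_exponent \<kappa> (s n) / (s n)\<^sup>2) powr \<gamma> * \<bar>t\<bar> powr (2 * \<gamma>)
      = real n * sds_exponent \<kappa> (s n) powr \<gamma>"
    using eventually_gt_at_top[of 0]
  proof eventually_elim
    case (elim n)
    then have "s n \<noteq> 0" using False by (simp add: s_def)
    moreover have "real n * (sds_exponent \<kappa> (s n) / (s n)\<^sup>2 * (s n)\<^sup>2) powr \<gamma>
        = (sds_exponent \<kappa> (s n) / (s n)\<^sup>2) powr \<gamma> * \<bar>t\<bar> powr (2 * \<gamma>)"
      using assms elim unfolding s_def
      by (intro scaled_square_powr divide_nonneg_nonneg sds_exponent_nonneg) auto
    ultimately show ?case by simp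
  qed
  ultimately show ?thesis
    unfolding s_def by (rule Lim_transform_eventually)
qed

lemma stable_constant_eq:
  fixes \<gamma> lam \<kappa> :: real
  assumes "0 \<le> \<kappa>" "\<kappa> < 1"
  shows "lam * ((1 + \<kappa>) / (2 * (1 - \<kappa>)\<^sup>2)) powr \<gamma>
           = (lam / 2 powr \<gamma>) * ((1 + \<kappa>) powr \<gamma> / (1 - \<kappa>) powr (2 * \<gamma>))"
proof -
  have "(1 - \<kappa>) powr (2 * \<gamma>) = ((1 - \<kappa>) powr 2) powr \<gamma>" by (simp only: powr_powr)
  then show ?thesis using assms by (simp add: powr_divide powr_mult)
qed

section \<open>Normal attraction\<close>

lemma char_normalized_sum:
  fixes X :: "nat \<Rightarrow> 'a \<Rightarrow> int"
  assumes "prob_space M" "prob_space.indep_vars M (\<lambda>_. count_space UNIV) X UNIV"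
    and distr_X: "\<And>i. distr M (count_space UNIV) (X i) = measure_pmf p"
  shows "char (distr M borel (\<lambda>\<omega>. a * (\<Sum>i<n. real_of_int (X i \<omega>)))) t = int_char p (a * t) ^ n"
proof -
  interpret prob_space M by fact
  have X [measurable]: "X i \<in> measurable M (count_space UNIV)" for i
    using assms(2) by (auto simp: indep_vars_def)
  have indep: "indep_vars (\<lambda>_. borel) (\<lambda>i \<omega>. a * real_of_int (X i \<omega>)) {..<n}"
    by (rule indep_vars_compose2[OF indep_vars_subset[OF assms(2)]]) auto
  have "char (distr M borel (\<lambda>\<omega>. a * real_of_int (X i \<omega>))) t = int_char p (a * t)" for i
  proof -
    have "char (distr M borel (\<lambda>\<omega>. a * real_of_int (X i \<omega>))) t
        = (\<integral>\<omega>. iexp (t * (a * real_of_int (X i \<omega>))) \<partial>M)"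
      by (simp add: char_def integral_distr)
    also have "\<dots> = (\<integral>k. iexp (t * (a * real_of_int k)) \<partial>distr M (count_space UNIV) (X i))"
      by (rule integral_distr[symmetric]) auto
    also have "\<dots> = int_char p (a * t)"
      by (simp add: distr_X int_char_eq mult_ac)
    finally show ?thesis .
  qed
  then show ?thesis
    using char_distr_sum[OF indep, of t] by (simp add: sum_distrib_left)
qed

theorem proposition5p9:
  fixes \<gamma> lam \<kappa> :: real
  assumes "0 < \<gamma>" and "\<gamma> \<le> 1" and "0 < lam" and "0 \<le> \<kappa>" and "\<kappa> < 1"
  shows "\<exists>L. symmetric_stable (2 * \<gamma>) L \<and>
             (\<forall>t. char L t = complex_of_real
                (exp (- (lam / 2 powr \<gamma>) * ((1 + \<kappa>) powr \<gamma> / (1 - \<kappa>) powr (2 * \<gamma>))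
                       * \<bar>t\<bar> powr (2 * \<gamma>)))) \<and>
             in_domain_of_normal_attraction TYPE('a) (SDS \<gamma> lam \<kappa>) (2 * \<gamma>) L"
proof -
  define K where "K = (1 + \<kappa>) / (2 * (1 - \<kappa>)\<^sup>2)"
  define E where "E n t = real n * sds_exponent \<kappa> (real n powr (- 1 / (2 * \<gamma>)) * t) powr \<gamma>" for n t
  define g where "g t = complex_of_real (exp (- (lam * K powr \<gamma>) * \<bar>t\<bar> powr (2 * \<gamma>)))" for t
  have K: "0 < K" using assms by (simp add: K_def)
  have sds_cf: "sds_cf \<gamma> (real n * lam) \<kappa> (real n powr (- 1 / (2 * \<gamma>)) * t) = exp (- lam * E n t)" for n t
    by (simp add: sds_cf_def E_def sds_exponent_def)
  have "(\<lambda>n. complex_of_real (exp (- lam * E n t)))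
      \<longlonglongrightarrow> complex_of_real (exp (- lam * (K powr \<gamma> * \<bar>t\<bar> powr (2 * \<gamma>))))" for t
    unfolding E_def K_def using assms by (intro tendsto_intros scaled_sds_exponent_tendsto) auto
  then have lim: "(\<lambda>n. complex_of_real (exp (- lam * E n t))) \<longlonglongrightarrow> g t" for t
    by (simp add: g_def mult.assoc)
  (* Indexed by Suc n, since the Poisson construction of the law needs a positive rate. *)
  define \<mu> where "\<mu> n = distr (distr (measure_pmf (SDS \<gamma> (real (Suc n) * lam) \<kappa>)) borel real_of_int) borel
    (\<lambda>x. real (Suc n) powr (- 1 / (2 * \<gamma>)) * x)" for n
  have \<mu>: "real_distribution (\<mu> n)" for n
    unfolding \<mu>_def
    by (intro prob_space.real_distribution_distr real_distribution.axioms(1)[OF real_distribution_int_pmf]) simp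
  have char_\<mu>: "char (\<mu> n) t = complex_of_real (exp (- lam * E (Suc n) t))" for n t
    unfolding \<mu>_def char_distr_mult[OF real_distribution_int_pmf] sds_cf[symmetric]
    using assms by (intro int_char_SDS) auto
  have bound: "1 - Re (char (\<mu> n) t) \<le> lam * K powr \<gamma> * \<bar>t\<bar> powr (2 * \<gamma>)" for n t
  proof -
    have "1 - Re (char (\<mu> n) t) \<le> lam * E (Suc n) t"
      using exp_ge_add_one_self[of "- lam * E (Suc n) t"] by (simp add: char_\<mu> del: exp_ge_add_one_self)
    also have "\<dots> \<le> lam * (K powr \<gamma> * \<bar>t\<bar> powr (2 * \<gamma>))"
      unfolding E_def K_def using assms by (intro mult_left_mono scaled_sds_exponent_le) simp_all
    finally show ?thesis by (simp add: mult.assoc)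
  qed
  have lim_\<mu>: "(\<lambda>n. char (\<mu> n) t) \<longlonglongrightarrow> g t" for t
    unfolding char_\<mu> using lim by (rule LIMSEQ_Suc)
  have index: "0 < 2 * \<gamma>" "2 * \<gamma> \<le> 2" using assms by auto
  obtain L where L: "real_distribution L" and char_L: "\<And>t. char L t = g t"
    by (rule exists_distribution_of_char_limit[OF \<mu> index bound lim_\<mu>]) (rule that)
  have "symmetric_stable (2 * \<gamma>) L"
    by (rule symmetric_stable_of_char[OF L, where c = "lam * K powr \<gamma>"])
       (use assms K in \<open>simp_all add: char_L g_def\<close>)
  moreover have "in_domain_of_normal_attraction TYPE('a) (SDS \<gamma> lam \<kappa>) (2 * \<gamma>) L"
    unfolding in_domain_of_normal_attraction_def
  proof (intro allI impI)
    fix M :: "'a measure" and X :: "nat \<Rightarrow> 'a \<Rightarrow> int"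
    assume M: "prob_space M" and indep: "prob_space.indep_vars M (\<lambda>_. count_space UNIV) X UNIV"
      and X: "\<forall>i. distr M (count_space UNIV) (X i) = measure_pmf (SDS \<gamma> lam \<kappa>)"
    interpret prob_space M by fact
    have [measurable]: "X i \<in> measurable M (count_space UNIV)" for i
      using indep by (auto simp: indep_vars_def)
    let ?S = "\<lambda>n. distr M borel (\<lambda>\<omega>. real n powr (- 1 / (2 * \<gamma>)) * (\<Sum>i<n. real_of_int (X i \<omega>)))"
    have "char (?S n) t = complex_of_real (exp (- lam * E n t))" for n t
    proof -
      have "char (?S n) t = complex_of_real (sds_cf \<gamma> lam \<kappa> (real n powr (- 1 / (2 * \<gamma>)) * t) ^ n)"
        unfolding char_normalized_sum[OF M indep spec[OF X]] int_char_SDS[OF assms] by simp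
      also have "sds_cf \<gamma> lam \<kappa> (real n powr (- 1 / (2 * \<gamma>)) * t) ^ n = exp (- lam * E n t)"
        unfolding sds_cf_def exp_of_nat_mult[symmetric] E_def sds_exponent_def by (rule arg_cong[OF mult.left_commute])
      finally show ?thesis .
    qed
    with lim show "weak_conv_m ?S L"
      by (intro levy_continuity L real_distribution_distr) (simp_all add: char_L)
  qed
  moreover have "char L t = complex_of_real
      (exp (- (lam / 2 powr \<gamma>) * ((1 + \<kappa>) powr \<gamma> / (1 - \<kappa>) powr (2 * \<gamma>)) * \<bar>t\<bar> powr (2 * \<gamma>)))" for t
    unfolding char_L g_def K_def stable_constant_eq[OF assms(4,5)] mult_minus_left ..
  ultimately show ?thesis by blast
qed

end
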